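(* Let $K$ be a finite abstract simplicial complex with geometric realization $|K|$. Then $\mathrm{TC}(|K|)\le \mathrm{TC}(K)$, where $\mathrm{TC}(|K|)$ is the (normalized) topological complexity of the topological space $|K|$ and $\mathrm{TC}(K)$ is the discrete topological complexity of the complex $K$.
   Context: Topological complexity (normalized): for a topological space $X$, let $PX$ be the space of continuous paths $\gamma\colon[0,1]\to X$ and $\pi\colon PX\to X\times X$, $\pi(\gamma)=(\gamma(0),\gamma(1))$. Then $\mathrm{TC}(X)$ is the minimum integer $n\ge 0$ such that $X\times X$ can be covered by open sets $V_0,\dots,V_n$ over each of which there is a continuous section $s_j\colon V_j\to PX$ of $\pi$, i.e. $\pi\circ s_j$ is the inclusion $V_j\subset X\times X$ ($\infty$ if there is no such $n$). Contiguity: two simplicial maps $\varphi,\psi\colon K\to L$ are contiguous ($\varphi\sim_c\psi$) if for every simplex $\sigma\in K$ the union of vertex sets $\varphi(\sigma)\cup\psi(\sigma)$ is a simplex of $L$. They are in the same contiguity class ($\varphi\sim\psi$) if there is a finite sequence of simplicial maps $\varphi=h_0\sim_c h_1\sim_c\cdots\sim_c h_m=\psi$ from $K$ to $L$. Categorical product: $K^2=K\,\Pi\,K$ is the simplicial complex with vertex set $V(K)\times V(K)$, in which a finite set $\sigma$ of vertices is a simplex if and only if both projections $\pi_1(\sigma)$ and $\pi_2(\sigma)$ are simplices of $K$. The diagonal $\Delta\colon K\to K^2$ is the simplicial map $\Delta(v)=(v,v)$. A subcomplex $\Omega\subset K^2$, with inclusion $\iota_\Omega\colon\Omega\to K^2$,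 is a Farber subcomplex if there exists a simplicial map $\sigma\colon\Omega\to K$ such that $\Delta\circ\sigma\sim\iota_\Omega$. The discrete topological complexity $\mathrm{TC}(K)$ is the least integer $n\ge 0$ such that $K^2=\Omega_0\cup\cdots\cup\Omega_n$ for some Farber subcomplexes $\Omega_0,\dots,\Omega_n$ of $K^2$ ($\infty$ if there is no such $n$). *)

theory Defs
  imports "HOL-Analysis.Analysis"
begin

section \<open>Topological complexity of a space\<close>

text \<open>
  Paths are extensional functions on the unit interval (value \<open>undefined\<close> elsewhere), so that two
  paths are equal precisely when they agree on the interval. As usual, the set of paths carries
  the compact-open topology; the sets below are its standard subbase (the choice \<open>C = {}\<close>
  yields the whole path space).
\<close>

definition paths :: "'a topology \<Rightarrow> (real \<Rightarrow> 'a) set" where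
  "paths X = {\<gamma> \<in> extensional {0..1}. pathin X \<gamma>}"

definition path_space :: "'a topology \<Rightarrow> (real \<Rightarrow> 'a) topology" where
  "path_space X = topology_generated_by
     {{\<gamma> \<in> paths X. \<gamma> ` C \<subseteq> U} | C U. compact C \<and> C \<subseteq> {0..1} \<and> openin X U}"

lemma topspace_path_space: "topspace (path_space X) = paths X"
proof -
  have "\<Union>{{\<gamma> \<in> paths X. \<gamma> ` C \<subseteq> U} | C U. compact C \<and> C \<subseteq> {0..1} \<and> openin X U} = paths X"
  proof (intro equalityI subsetI)
    fix \<gamma> assume "\<gamma> \<in> paths X"
    moreover have "compact ({} :: real set)" "openin X {}" by auto
    ultimately show "\<gamma> \<in> \<Union>{{\<gamma> \<in> paths X. \<gamma> ` C \<subseteq> U} | C U. compact C \<and> C \<subseteq> {0..1} \<and> openin X U}"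
      by fastforce
  qed blast
  then show ?thesis
    by (simp add: path_space_def topology_generated_by_topspace)
qed

definition path_ends :: "(real \<Rightarrow> 'a) \<Rightarrow> 'a \<times> 'a" where
  "path_ends \<gamma> = (\<gamma> 0, \<gamma> 1)"

definition has_path_section :: "'a topology \<Rightarrow> ('a \<times> 'a) set \<Rightarrow> bool" where
  "has_path_section X V \<longleftrightarrow>
     (\<exists>s. continuous_map (subtopology (prod_topology X X) V) (path_space X) s \<and>
          (\<forall>z\<in>V. path_ends (s z) = z))"

text \<open>In \<^typ>\<open>enat\<close>, the infimum of the empty set is \<open>\<infinity>\<close> and any other infimum is attained.\<close>

definition topological_complexity :: "'a topology \<Rightarrow> enat" where
  "topological_complexity X = Inf {enat n | n. \<exists>V :: nat \<Rightarrow> ('a \<times> 'a) set.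
     (\<forall>j\<le>n. openin (prod_topology X X) (V j) \<and> has_path_section X (V j)) \<and>
     topspace (prod_topology X X) = (\<Union>j\<le>n. V j)}"


section \<open>Abstract simplicial complexes\<close>

text \<open>
  A complex is given by its set of simplices, which are finite and nonempty; its vertices are
  the elements of its simplices.
\<close>

definition abstract_complex :: "'a set set \<Rightarrow> bool" where
  "abstract_complex K \<longleftrightarrow>
     (\<forall>\<sigma>\<in>K. finite \<sigma> \<and> \<sigma> \<noteq> {}) \<and> (\<forall>\<sigma>\<in>K. \<forall>\<tau>. \<tau> \<noteq> {} \<and> \<tau> \<subseteq> \<sigma> \<longrightarrow> \<tau> \<in> K)"

definition vertices :: "'a set set \<Rightarrow> 'a set" where
  "vertices K = \<Union>K"

definition subcomplex :: "'a set set \<Rightarrow> 'a set set \<Rightarrow> bool" where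
  "subcomplex \<Omega> K \<longleftrightarrow> abstract_complex \<Omega> \<and> \<Omega> \<subseteq> K"

text \<open>
  Points of the realization are given by barycentric coordinates, extended by \<open>0\<close> off the
  vertex set. The topology is that of pointwise convergence of the coordinates; for a finite
  complex (the only case of interest here) it is the usual topology of the realization.
\<close>

definition realization_points :: "'a set set \<Rightarrow> ('a \<Rightarrow> real) set" where
  "realization_points K =
     {\<alpha>. (\<forall>v. 0 \<le> \<alpha> v) \<and> {v. \<alpha> v \<noteq> 0} \<in> K \<and> (\<Sum>v | \<alpha> v \<noteq> 0. \<alpha> v) = 1}"

definition realization :: "'a set set \<Rightarrow> ('a \<Rightarrow> real) topology" where
  "realization K = top_of_set (realization_points K)"

text \<open>
  Simplicial maps are represented by total functions of which only the values on the vertices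
  of the source matter. In particular, two simplicial maps that agree on the vertices of the
  source are contiguous, so contiguity classes do not depend on the values elsewhere.
\<close>

definition simplicial_map :: "'a set set \<Rightarrow> 'b set set \<Rightarrow> ('a \<Rightarrow> 'b) \<Rightarrow> bool" where
  "simplicial_map K L \<phi> \<longleftrightarrow> (\<forall>\<sigma>\<in>K. \<phi> ` \<sigma> \<in> L)"

definition contiguous :: "'a set set \<Rightarrow> 'b set set \<Rightarrow> ('a \<Rightarrow> 'b) \<Rightarrow> ('a \<Rightarrow> 'b) \<Rightarrow> bool" where
  "contiguous K L \<phi> \<psi> \<longleftrightarrow> (\<forall>\<sigma>\<in>K. \<phi> ` \<sigma> \<union> \<psi> ` \<sigma> \<in> L)"

definition same_contiguity_class ::
    "'a set set \<Rightarrow> 'b set set \<Rightarrow> ('a \<Rightarrow> 'b) \<Rightarrow> ('a \<Rightarrow> 'b) \<Rightarrow> bool" where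
  "same_contiguity_class K L \<phi> \<psi> \<longleftrightarrow>
     (\<exists>(m::nat) h. h 0 = \<phi> \<and> h m = \<psi> \<and> (\<forall>i\<le>m. simplicial_map K L (h i)) \<and>
                   (\<forall>i<m. contiguous K L (h i) (h (Suc i))))"

definition categorical_product :: "'a set set \<Rightarrow> 'b set set \<Rightarrow> ('a \<times> 'b) set set" where
  "categorical_product K L =
     {\<sigma>. finite \<sigma> \<and> \<sigma> \<subseteq> vertices K \<times> vertices L \<and> fst ` \<sigma> \<in> K \<and> snd ` \<sigma> \<in> L}"

definition diagonal :: "'a \<Rightarrow> 'a \<times> 'a" where
  "diagonal v = (v, v)"


section \<open>Discrete topological complexity\<close>

definition farber_subcomplex :: "'a set set \<Rightarrow> ('a \<times> 'a) set set \<Rightarrow> bool" where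
  "farber_subcomplex K \<Omega> \<longleftrightarrow>
     subcomplex \<Omega> (categorical_product K K) \<and>
     (\<exists>\<sigma>. simplicial_map \<Omega> K \<sigma> \<and>
          same_contiguity_class \<Omega> (categorical_product K K) (diagonal \<circ> \<sigma>) id)"

definition discrete_topological_complexity :: "'a set set \<Rightarrow> enat" where
  "discrete_topological_complexity K = Inf {enat n | n. \<exists>\<Omega> :: nat \<Rightarrow> ('a \<times> 'a) set set.
     (\<forall>j\<le>n. farber_subcomplex K (\<Omega> j)) \<and> categorical_product K K = (\<Union>j\<le>n. \<Omega> j)}"

end

theory Submission
  imports Defs
begin

text \<open>
  The three maps \<open>pr\<^sub>1 \<circ> \<iota>\<close>, \<open>\<sigma>\<close> and \<open>pr\<^sub>2 \<circ> \<iota>\<close> from a Farber subcomplex \<open>\<Omega>\<close> to \<open>K\<close> lie in one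
  contiguity class: compose \<open>\<Delta> \<circ> \<sigma> \<sim> \<iota>\<close> with the two projections. Contiguous maps have realizations
  joined by a straight-line homotopy inside the simplices of \<open>K\<close>, so
  \<open>|pr\<^sub>1|\<close> and \<open>|pr\<^sub>2|\<close> are homotopic as maps \<open>|\<Omega>| \<rightarrow> |K|\<close>
  (\<open>farber_subcomplex_projections_homotopic\<close>). On the other side, a homotopy
  between the two coordinate projections \<open>V \<rightarrow> |K|\<close> of an open \<open>V \<subseteq> |K| \<times> |K|\<close> is, by currying, a
  section of the path fibration over \<open>V\<close> (\<open>has_path_section_if_projections_homotopic\<close>).

  The tensor product \<open>\<alpha> \<otimes> \<beta>\<close> of barycentric coordinates maps \<open>|K| \<times> |K|\<close> to \<open>|K\<^sup>2|\<close>. It thus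
  provides path sections over the preimages of the \<open>|\<Omega>|\<close>, but these are closed and in general not
  open. To obtain open sets, coordinates are first truncated: with \<open>N\<close> vertices and \<open>c = 1 / (2 N)\<close>, the map \<open>t\<close> replaces each
  coordinate \<open>x\<close> by \<open>max 0 (x - c)\<close> and normalizes. It is continuous, keeps every point
  in its own simplex, and the support of \<open>t \<alpha>\<close> lies in the set \<open>L \<alpha> = {v. c \<le> \<alpha> v}\<close>, which is
  nonempty and upper semicontinuous: it can only shrink under a small perturbation
  of \<open>\<alpha>\<close>. As subcomplexes are closed under passing to faces,
  \<open>V = {(\<alpha>, \<beta>). L \<alpha> \<times> L \<beta> \<in> \<Omega>}\<close> is open, and \<open>t \<alpha> \<otimes> t \<beta> \<in> |\<Omega>|\<close> there.
  If subcomplexes \<open>\<Omega>\<close> cover \<open>K\<^sup>2\<close>, then the sets \<open>V\<close> cover \<open>|K| \<times> |K|\<close>, because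
  \<open>L \<alpha> \<times> L \<beta>\<close> is a simplex of \<open>K\<^sup>2\<close>. Over \<open>V\<close> one has the homotopies
  \<open>\<alpha> \<simeq> t \<alpha> = |pr\<^sub>1| (t \<alpha> \<otimes> t \<beta>) \<simeq> |pr\<^sub>2| (t \<alpha> \<otimes> t \<beta>) = t \<beta> \<simeq> \<beta>\<close>.
\<close>


section \<open>Path sections from homotopies\<close>

text \<open>
  For a compact set \<open>C\<close> of times and an open set \<open>U\<close>, the points whose path
  maps \<open>C\<close> into \<open>U\<close> form an open set, since their complement is the image of a closed set under
  the projection along the compact factor \<open>C\<close>, which is a closed map.
\<close>

lemma continuous_map_curry_path_space:
  assumes h: "continuous_map (prod_topology (top_of_set {0..1}) X) Y h"
  shows "continuous_map X (path_space Y) (\<lambda>z. restrict (\<lambda>t. h (t, z)) {0..1})"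
proof -
  define s where "s = (\<lambda>z. restrict (\<lambda>t. h (t, z)) {0..1::real})"
  have s_paths: "s z \<in> paths Y" if "z \<in> topspace X" for z
  proof -
    have "continuous_map (top_of_set {0..1}) Y (\<lambda>t. h (t, z))"
    proof -
      have "continuous_map (top_of_set {0..1}) (prod_topology (top_of_set {0..1}) X)
              (\<lambda>t. (t, z))"
        using that by (intro continuous_intros) auto
      from continuous_map_compose[OF this h] show ?thesis by (simp add: o_def)
    qed
    then have "continuous_map (top_of_set {0..1}) Y (s z)"
      by (rule continuous_map_eq) (simp add: s_def)
    then show ?thesis by (simp add: paths_def pathin_def s_def)
  qed
  have "continuous_map X (path_space Y) s"
    unfolding path_space_def
  proof (rule continuous_on_generated_topo)
    fix W assume "W \<in> {{\<gamma> \<in> paths Y. \<gamma> ` C \<subseteq> U} |C U. compact C \<and> C \<subseteq> {0..1} \<and> openin Y U}"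
    then obtain C U where W: "W = {\<gamma> \<in> paths Y. \<gamma> ` C \<subseteq> U}"
      and C: "compact C" "C \<subseteq> {0..1}" and U: "openin Y U" by blast
    let ?CX = "prod_topology (top_of_set C) X"
    let ?bad = "{p \<in> topspace ?CX. h p \<in> topspace Y - U}"
    have "continuous_map ?CX Y h"
    proof -
      have "?CX = subtopology (prod_topology (top_of_set {0..1}) X) (C \<times> topspace X)"
        using C(2) prod_topology_subtopology(1)[of "top_of_set {0..1}" C X]
        by (simp add: subtopology_subtopology Int_absorb1)
      then show ?thesis
        using continuous_map_from_subtopology[OF h] by simp
    qed
    then have "closedin ?CX ?bad"
      using U by (intro closedin_continuous_map_preimage) auto
    moreover have "compact_space (top_of_set C)"
      using C(1) by (simp add: compact_space_subtopology)
    ultimately have "closedin X (snd ` ?bad)"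
      using closed_map_snd closed_map_def by blast
    moreover have "s -` W \<inter> topspace X = topspace X - snd ` ?bad"
    proof -
      have val: "h (t, z) \<in> topspace Y" if "z \<in> topspace X" "t \<in> C" for t z
        using that C(2) continuous_map_image_subset_topspace[OF h] by auto
      have "s z ` C \<subseteq> U \<longleftrightarrow> (\<forall>t\<in>C. h (t, z) \<in> U)" for z
        using C(2) by (auto simp: s_def subset_iff)
      then show ?thesis
        using s_paths val by (force simp: W image_iff)
    qed
    ultimately show "openin X (s -` W \<inter> topspace X)"
      by (simp add: openin_diff)
  next
    have "\<Union>{{\<gamma> \<in> paths Y. \<gamma> ` C \<subseteq> U} |C U. compact C \<and> C \<subseteq> {0..1} \<and> openin Y U} = paths Y"
      using topspace_path_space[of Y]
      unfolding path_space_def topology_generated_by_topspace .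
    then show "s ` topspace X
        \<subseteq> \<Union>{{\<gamma> \<in> paths Y. \<gamma> ` C \<subseteq> U} |C U. compact C \<and> C \<subseteq> {0..1} \<and> openin Y U}"
      using s_paths by auto
  qed
  then show ?thesis unfolding s_def .
qed

lemma has_path_section_if_projections_homotopic:
  assumes "homotopic_with (\<lambda>_. True) (subtopology (prod_topology X X) V) X fst snd"
  shows "has_path_section X V"
proof -
  obtain h where
    h: "continuous_map (prod_topology (top_of_set {0..1::real})
          (subtopology (prod_topology X X) V)) X h"
    and h0: "\<And>z. h (0, z) = fst z" and h1: "\<And>z. h (1, z) = snd z"
    using assms unfolding homotopic_with_def by auto
  show ?thesis
    unfolding has_path_section_def
    by (intro exI conjI ballI, rule continuous_map_curry_path_space[OF h])
       (simp add: path_ends_def h0 h1)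
qed


section \<open>Points and maps of realizations\<close>

lemma abstract_complex_finite: "abstract_complex K \<Longrightarrow> \<sigma> \<in> K \<Longrightarrow> finite \<sigma>"
  unfolding abstract_complex_def by blast

lemma abstract_complex_face:
  "abstract_complex K \<Longrightarrow> \<sigma> \<in> K \<Longrightarrow> \<tau> \<subseteq> \<sigma> \<Longrightarrow> \<tau> \<noteq> {} \<Longrightarrow> \<tau> \<in> K"
  unfolding abstract_complex_def by blast

lemma realization_pointsI:
  assumes "abstract_complex K" "\<sigma> \<in> K" "\<And>v. 0 \<le> \<alpha> v" "{v. \<alpha> v \<noteq> 0} \<subseteq> \<sigma>" "sum \<alpha> \<sigma> = 1"
  shows "\<alpha> \<in> realization_points K"
proof -
  have "finite \<sigma>" using assms(1,2) by (rule abstract_complex_finite)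
  then have "sum \<alpha> {v. \<alpha> v \<noteq> 0} = sum \<alpha> \<sigma>"
    using assms(4) by (intro sum.mono_neutral_left) auto
  with assms(5) have sum: "sum \<alpha> {v. \<alpha> v \<noteq> 0} = 1" by metis
  then have "{v. \<alpha> v \<noteq> 0} \<noteq> {}" by (metis sum.empty zero_neq_one)
  then have "{v. \<alpha> v \<noteq> 0} \<in> K"
    by (rule abstract_complex_face[OF assms(1,2,4)])
  then show ?thesis using assms(3) sum by (simp add: realization_points_def)
qed

lemma realization_points_nonneg: "\<alpha> \<in> realization_points K \<Longrightarrow> 0 \<le> \<alpha> v"
  by (simp add: realization_points_def)

lemma realization_points_support: "\<alpha> \<in> realization_points K \<Longrightarrow> {v. \<alpha> v \<noteq> 0} \<in> K"
  by (simp add: realization_points_def)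

lemma realization_points_zero: "\<alpha> \<in> realization_points K \<Longrightarrow> v \<notin> vertices K \<Longrightarrow> \<alpha> v = 0"
  by (auto simp: realization_points_def vertices_def)

lemma realization_points_sum:
  assumes "\<alpha> \<in> realization_points K" "finite S" "{v. \<alpha> v \<noteq> 0} \<subseteq> S"
  shows "sum \<alpha> S = 1"
proof -
  have "sum \<alpha> {v. \<alpha> v \<noteq> 0} = sum \<alpha> S"
    using assms(2,3) by (intro sum.mono_neutral_left) auto
  then show ?thesis using assms(1) by (simp add: realization_points_def)
qed

lemma realization_points_sum_vertices:
  assumes "\<alpha> \<in> realization_points K" "finite (vertices K)"
  shows "sum \<alpha> (vertices K) = 1"
  using assms realization_points_zero[OF assms(1)] by (intro realization_points_sum) auto

lemma continuous_on_coordinate: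
  fixes f :: "'c::topological_space \<Rightarrow> 'a \<Rightarrow> real"
  assumes "continuous_on S f"
  shows "continuous_on S (\<lambda>z. f z v)"
  using continuous_on_compose2[OF continuous_on_product_coordinates[of v] assms] by simp

text \<open>
  Each segment from \<open>f z\<close> to \<open>g z\<close> stays in the simplex spanned by the two supports.
\<close>

lemma homotopic_straight_line:
  fixes f g :: "'c::topological_space \<Rightarrow> 'a \<Rightarrow> real"
  assumes K: "abstract_complex K"
    and f: "continuous_on S f" "f ` S \<subseteq> realization_points K"
    and g: "continuous_on S g" "g ` S \<subseteq> realization_points K"
    and carrier: "\<And>z. z \<in> S \<Longrightarrow> {v. f z v \<noteq> 0} \<union> {v. g z v \<noteq> 0} \<in> K"
  shows "homotopic_with_canon (\<lambda>_. True) S (realization_points K) f g"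
proof -
  define h where "h = (\<lambda>(t::real, z) v. (1 - t) * f z v + t * g z v)"
  have snd_cont: "continuous_on ({0..1::real} \<times> S) snd" "snd ` ({0..1::real} \<times> S) \<subseteq> S"
    by (auto intro: continuous_on_snd continuous_on_id)
  note coords = continuous_on_coordinate[OF continuous_on_compose2[OF f(1) snd_cont]]
    continuous_on_coordinate[OF continuous_on_compose2[OF g(1) snd_cont]]
  have "continuous_on ({0..1} \<times> S) (\<lambda>p. (1 - fst p) * f (snd p) v + fst p * g (snd p) v)" for v
    by (intro continuous_on_add continuous_on_mult continuous_on_diff continuous_on_const
        continuous_on_fst continuous_on_id coords)
  then have cont: "continuous_on ({0..1} \<times> S) h"
    by (intro continuous_on_coordinatewise_then_product) (simp add: h_def case_prod_unfold)
  have "h (t, z) \<in> realization_points K" if t: "t \<in> {0..1}" and z: "z \<in> S" for t z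
  proof (rule realization_pointsI[OF K carrier[OF z]])
    let ?\<sigma> = "{v. f z v \<noteq> 0} \<union> {v. g z v \<noteq> 0}"
    have fz: "f z \<in> realization_points K" and gz: "g z \<in> realization_points K"
      using f(2) g(2) z by auto
    show "0 \<le> h (t, z) v" for v
      using t realization_points_nonneg[OF fz] realization_points_nonneg[OF gz]
      by (simp add: h_def)
    show "{v. h (t, z) v \<noteq> 0} \<subseteq> ?\<sigma>" by (auto simp: h_def)
    have "finite ?\<sigma>" using K carrier[OF z] by (rule abstract_complex_finite)
    then have "sum (f z) ?\<sigma> = 1" "sum (g z) ?\<sigma> = 1"
      by (auto intro!: realization_points_sum[OF fz] realization_points_sum[OF gz])
    moreover have "sum (h (t, z)) ?\<sigma> = (1 - t) * sum (f z) ?\<sigma> + t * sum (g z) ?\<sigma>"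
      by (simp only: h_def case_prod_conv sum.distrib sum_distrib_left)
    ultimately show "sum (h (t, z)) ?\<sigma> = 1"
      by (metis mult.right_neutral diff_add_cancel)
  qed
  then have "h ` ({0..1} \<times> S) \<subseteq> realization_points K" by auto
  then show ?thesis
    unfolding homotopic_with_def
    using cont by (intro exI[of _ h]) (auto simp: h_def prod_topology_subtopology_eu)
qed

definition realize_map :: "'a set set \<Rightarrow> ('a \<Rightarrow> 'b) \<Rightarrow> ('a \<Rightarrow> real) \<Rightarrow> 'b \<Rightarrow> real" where
  "realize_map K \<phi> \<alpha> w = (\<Sum>v\<in>vertices K. if \<phi> v = w then \<alpha> v else 0)"

lemma continuous_on_realize_map: "continuous_on S (realize_map K \<phi>)"
proof (rule continuous_on_coordinatewise_then_product)
  fix w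
  have "continuous_on S (\<lambda>\<alpha>. if \<phi> v = w then \<alpha> v else (0::real))" for v
    using continuous_on_coordinate[OF continuous_on_id[of S], of v]
    by (cases "\<phi> v = w") simp_all
  then show "continuous_on S (\<lambda>\<alpha>. realize_map K \<phi> \<alpha> w)"
    unfolding realize_map_def by (intro continuous_intros)
qed

lemma realize_map_support:
  assumes "\<alpha> \<in> realization_points K" "finite (vertices K)"
  shows "{w. realize_map K \<phi> \<alpha> w \<noteq> 0} = \<phi> ` {v. \<alpha> v \<noteq> 0}"
proof -
  have "realize_map K \<phi> \<alpha> w = 0 \<longleftrightarrow> (\<forall>v\<in>vertices K. \<phi> v = w \<longrightarrow> \<alpha> v = 0)" for w
    unfolding realize_map_def
    using assms by (subst sum_nonneg_eq_0_iff) (auto simp: realization_points_nonneg)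
  then show ?thesis
    using realization_points_zero[OF assms(1)] by blast
qed

lemma realize_map_in_realization_points:
  assumes L: "abstract_complex L" and fin: "finite (vertices K)"
    and \<phi>: "simplicial_map K L \<phi>" and \<alpha>: "\<alpha> \<in> realization_points K"
  shows "realize_map K \<phi> \<alpha> \<in> realization_points L"
proof (rule realization_pointsI[OF L])
  let ?\<sigma> = "\<phi> ` {v. \<alpha> v \<noteq> 0}"
  show \<sigma>: "?\<sigma> \<in> L"
    using \<phi> realization_points_support[OF \<alpha>] by (simp add: simplicial_map_def)
  show "0 \<le> realize_map K \<phi> \<alpha> w" for w
    by (auto simp: realize_map_def intro!: sum_nonneg realization_points_nonneg[OF \<alpha>])
  show "{w. realize_map K \<phi> \<alpha> w \<noteq> 0} \<subseteq> ?\<sigma>"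
    by (rule equalityD1[OF realize_map_support[OF \<alpha> fin]])
  have "finite ?\<sigma>" using L \<sigma> by (rule abstract_complex_finite)
  then have "sum (realize_map K \<phi> \<alpha>) ?\<sigma>
      = (\<Sum>v\<in>vertices K. if \<phi> v \<in> ?\<sigma> then \<alpha> v else 0)"
    unfolding realize_map_def by (subst sum.swap) (simp add: sum.delta')
  also have "\<dots> = sum \<alpha> (vertices K)"
    by (intro sum.cong) auto
  also have "\<dots> = 1" by (rule realization_points_sum_vertices[OF \<alpha> fin])
  finally show "sum (realize_map K \<phi> \<alpha>) ?\<sigma> = 1" .
qed

lemma contiguous_imp_homotopic:
  assumes L: "abstract_complex L" and fin: "finite (vertices K)"
    and \<phi>: "simplicial_map K L \<phi>" and \<psi>: "simplicial_map K L \<psi>"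
    and contig: "contiguous K L \<phi> \<psi>"
  shows "homotopic_with_canon (\<lambda>_. True) (realization_points K) (realization_points L)
           (realize_map K \<phi>) (realize_map K \<psi>)"
proof (rule homotopic_straight_line[OF L])
  fix \<alpha> assume \<alpha>: "\<alpha> \<in> realization_points K"
  show "{w. realize_map K \<phi> \<alpha> w \<noteq> 0} \<union> {w. realize_map K \<psi> \<alpha> w \<noteq> 0} \<in> L"
    using contig realization_points_support[OF \<alpha>]
    by (simp add: realize_map_support[OF \<alpha> fin] contiguous_def)
qed (use realize_map_in_realization_points[OF L fin \<phi>]
         realize_map_in_realization_points[OF L fin \<psi>] in
       \<open>simp_all add: continuous_on_realize_map image_subset_iff\<close>)

lemma same_contiguity_class_imp_homotopic:
  assumes L: "abstract_complex L" and fin: "finite (vertices K)"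
    and "same_contiguity_class K L \<phi> \<psi>"
  shows "homotopic_with_canon (\<lambda>_. True) (realization_points K) (realization_points L)
           (realize_map K \<phi>) (realize_map K \<psi>)"
proof -
  obtain m :: nat and h where h: "h 0 = \<phi>" "h m = \<psi>"
    and simplicial: "\<forall>i\<le>m. simplicial_map K L (h i)"
    and contig: "\<forall>i<m. contiguous K L (h i) (h (Suc i))"
    using assms(3) unfolding same_contiguity_class_def by (elim exE conjE)
  have "homotopic_with_canon (\<lambda>_. True) (realization_points K) (realization_points L)
          (realize_map K (h 0)) (realize_map K (h i))" if "i \<le> m" for i
    using that
  proof (induction i)
    case 0
    then show ?case
      using realize_map_in_realization_points[OF L fin simplicial[rule_format, of 0]]
      by (auto intro: continuous_on_realize_map)
  next
    case (Suc i)
    then have "homotopic_with_canon (\<lambda>_. True) (realization_points K) (realization_points L)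
          (realize_map K (h i)) (realize_map K (h (Suc i)))"
      by (intro contiguous_imp_homotopic[OF L fin] simplicial[rule_format] contig[rule_format]) auto
    with Suc show ?case using homotopic_with_trans Suc_leD by blast
  qed
  from this[of m] show ?thesis by (simp add: h)
qed


section \<open>Farber subcomplexes\<close>

lemma same_contiguity_class_compose:
  assumes "same_contiguity_class K L \<phi> \<psi>" "simplicial_map L M \<theta>"
  shows "same_contiguity_class K M (\<theta> \<circ> \<phi>) (\<theta> \<circ> \<psi>)"
proof -
  obtain m :: nat and h where h: "h 0 = \<phi>" "h m = \<psi>"
    "\<forall>i\<le>m. simplicial_map K L (h i)" "\<forall>i<m. contiguous K L (h i) (h (Suc i))"
    using assms(1) unfolding same_contiguity_class_def by (elim exE conjE)
  have "\<forall>i\<le>m. simplicial_map K M (\<theta> \<circ> h i)"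
    using h(3) assms(2) unfolding simplicial_map_def image_comp[symmetric] by blast
  moreover have "\<forall>i<m. contiguous K M (\<theta> \<circ> h i) (\<theta> \<circ> h (Suc i))"
    using h(4) assms(2)
    unfolding simplicial_map_def contiguous_def image_comp[symmetric] image_Un[symmetric] by blast
  ultimately show ?thesis
    unfolding same_contiguity_class_def using h(1,2)
    by (intro exI[of _ m] exI[of _ "\<lambda>i. \<theta> \<circ> h i"]) auto
qed

text \<open>
  Both projections are left inverses of the diagonal, so composing \<open>\<Delta> \<circ> \<sigma> \<sim> \<iota>\<close> with either of them
  puts it in the contiguity class of \<open>\<sigma>\<close>.
\<close>

lemma farber_subcomplex_projections_homotopic:
  assumes K: "abstract_complex K" and fin: "finite (vertices \<Omega>)"
    and \<Omega>: "farber_subcomplex K \<Omega>"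
  shows "homotopic_with_canon (\<lambda>_. True) (realization_points \<Omega>) (realization_points K)
           (realize_map \<Omega> fst) (realize_map \<Omega> snd)"
proof -
  obtain \<sigma> where
    \<sigma>: "same_contiguity_class \<Omega> (categorical_product K K) (diagonal \<circ> \<sigma>) id"
    using \<Omega> unfolding farber_subcomplex_def by blast
  have "simplicial_map (categorical_product K K) K fst"
    "simplicial_map (categorical_product K K) K snd"
    by (auto simp: simplicial_map_def categorical_product_def)
  from this[THEN same_contiguity_class_compose[OF \<sigma>]]
  have "same_contiguity_class \<Omega> K \<sigma> fst" "same_contiguity_class \<Omega> K \<sigma> snd"
    by (simp_all add: o_def diagonal_def)
  note homs = this[THEN same_contiguity_class_imp_homotopic[OF K fin]]
  show ?thesis by (rule homotopic_with_trans[OF homotopic_with_symD[OF homs(1)] homs(2)])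
qed


section \<open>Truncating barycentric coordinates\<close>

text \<open>
  With \<open>N\<close> vertices, the largest coordinate of any point is at least \<open>1 / N\<close>. The factor \<open>2\<close> keeps
  the cutoff strictly below this value, so that truncation never annihilates a point.
\<close>

definition cutoff :: "'a set set \<Rightarrow> real" where
  "cutoff K = 1 / (2 * real (card (vertices K)))"

definition large_vertices :: "'a set set \<Rightarrow> ('a \<Rightarrow> real) \<Rightarrow> 'a set" where
  "large_vertices K \<alpha> = {v \<in> vertices K. cutoff K \<le> \<alpha> v}"

definition excess :: "'a set set \<Rightarrow> ('a \<Rightarrow> real) \<Rightarrow> 'a \<Rightarrow> real" where
  "excess K \<alpha> v = max 0 (\<alpha> v - cutoff K)"

definition truncate :: "'a set set \<Rightarrow> ('a \<Rightarrow> real) \<Rightarrow> 'a \<Rightarrow> real" where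
  "truncate K \<alpha> v = excess K \<alpha> v / sum (excess K \<alpha>) (vertices K)"

lemma excess_nonneg: "0 \<le> excess K \<alpha> v"
  by (simp add: excess_def)

context
  fixes K :: "'a set set"
  assumes K: "abstract_complex K" and fin: "finite (vertices K)"
begin

lemma card_vertices_pos:
  assumes "\<alpha> \<in> realization_points K"
  shows "0 < card (vertices K)"
  using realization_points_sum_vertices[OF assms fin] fin by (auto simp: card_gt_0_iff)

lemma cutoff_pos:
  assumes "\<alpha> \<in> realization_points K"
  shows "0 < cutoff K"
  using card_vertices_pos[OF assms] by (simp add: cutoff_def)

lemma ex_coordinate_above_cutoff:
  assumes \<alpha>: "\<alpha> \<in> realization_points K"
  shows "\<exists>v\<in>vertices K. cutoff K < \<alpha> v"
proof (rule ccontr)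
  assume "\<not> ?thesis"
  then have "sum \<alpha> (vertices K) \<le> (\<Sum>v\<in>vertices K. cutoff K)"
    by (intro sum_mono) force
  also have "\<dots> = 1 / 2"
    using card_vertices_pos[OF \<alpha>] by (simp add: cutoff_def)
  finally show False using realization_points_sum_vertices[OF \<alpha> fin] by simp
qed

lemma sum_excess_pos:
  assumes "\<alpha> \<in> realization_points K"
  shows "0 < sum (excess K \<alpha>) (vertices K)"
proof -
  obtain v where "v \<in> vertices K" "cutoff K < \<alpha> v"
    using ex_coordinate_above_cutoff[OF assms] by blast
  then show ?thesis
    by (intro sum_pos2[OF fin, of v]) (auto simp: excess_def)
qed

lemma large_vertices_nonempty: "\<alpha> \<in> realization_points K \<Longrightarrow> large_vertices K \<alpha> \<noteq> {}"
  using ex_coordinate_above_cutoff by (force simp: large_vertices_def)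

lemma large_vertices_simplex:
  assumes \<alpha>: "\<alpha> \<in> realization_points K"
  shows "large_vertices K \<alpha> \<in> K"
proof -
  have "large_vertices K \<alpha> \<subseteq> {v. \<alpha> v \<noteq> 0}"
    using cutoff_pos[OF \<alpha>] by (auto simp: large_vertices_def)
  with K realization_points_support[OF \<alpha>] show ?thesis
    using large_vertices_nonempty[OF \<alpha>] by (rule abstract_complex_face)
qed

lemma excess_eq_0:
  assumes "\<alpha> \<in> realization_points K" "v \<notin> large_vertices K \<alpha>"
  shows "excess K \<alpha> v = 0"
  using assms cutoff_pos[OF assms(1)] realization_points_zero[OF assms(1), of v]
  by (cases "v \<in> vertices K") (auto simp: excess_def large_vertices_def)

lemma truncate_nonneg: "0 \<le> truncate K \<alpha> v"
  by (simp add: truncate_def excess_nonneg sum_nonneg)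

lemma truncate_support:
  assumes "\<alpha> \<in> realization_points K"
  shows "{v. truncate K \<alpha> v \<noteq> 0} \<subseteq> large_vertices K \<alpha>"
  using excess_eq_0[OF assms] by (auto simp: truncate_def)

lemma sum_truncate:
  assumes "\<alpha> \<in> realization_points K"
  shows "sum (truncate K \<alpha>) (large_vertices K \<alpha>) = 1"
proof -
  have "sum (excess K \<alpha>) (large_vertices K \<alpha>) = sum (excess K \<alpha>) (vertices K)"
    using fin excess_eq_0[OF assms]
    by (intro sum.mono_neutral_left) (auto simp: large_vertices_def)
  then show ?thesis
    using sum_excess_pos[OF assms] by (simp add: truncate_def flip: sum_divide_distrib)
qed

lemma truncate_in_realization_points:
  assumes "\<alpha> \<in> realization_points K"
  shows "truncate K \<alpha> \<in> realization_points K"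
  using realization_pointsI[OF K large_vertices_simplex[OF assms] truncate_nonneg
      truncate_support[OF assms] sum_truncate[OF assms]] .

lemma continuous_on_truncate: "continuous_on (realization_points K) (truncate K)"
proof (rule continuous_on_coordinatewise_then_product)
  fix v
  have "continuous_on (realization_points K) (\<lambda>\<alpha>. excess K \<alpha> w)" for w
    unfolding excess_def
    by (intro continuous_on_max continuous_on_diff continuous_on_const
        continuous_on_coordinate[OF continuous_on_id])
  then show "continuous_on (realization_points K) (\<lambda>\<alpha>. truncate K \<alpha> v)"
    unfolding truncate_def using sum_excess_pos
    by (intro continuous_on_divide continuous_on_sum) force+
qed

text \<open>
  Truncation only shrinks supports, so each point stays in its own simplex and the straight-line
  homotopy applies.
\<close>

lemma truncate_homotopic_id:
  "homotopic_with_canon (\<lambda>_. True) (realization_points K) (realization_points K) id (truncate K)"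
proof (rule homotopic_straight_line[OF K])
  fix \<alpha> assume \<alpha>: "\<alpha> \<in> realization_points K"
  have "{v. truncate K \<alpha> v \<noteq> 0} \<subseteq> {v. \<alpha> v \<noteq> 0}"
    using truncate_support[OF \<alpha>] cutoff_pos[OF \<alpha>] by (fastforce simp: large_vertices_def)
  then have "{v. id \<alpha> v \<noteq> 0} \<union> {v. truncate K \<alpha> v \<noteq> 0} = {v. \<alpha> v \<noteq> 0}" by auto
  then show "{v. id \<alpha> v \<noteq> 0} \<union> {v. truncate K \<alpha> v \<noteq> 0} \<in> K"
    using realization_points_support[OF \<alpha>] by metis
qed (use truncate_in_realization_points continuous_on_truncate in auto)

end

text \<open>
  The finitely many strict inequalities \<open>\<alpha> v < cutoff K\<close> at a point persist nearby.
\<close>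

lemma large_vertices_upper_semicontinuous:
  assumes "finite (vertices K)"
  obtains U where "open U" "\<alpha> \<in> U" "\<And>\<beta>. \<beta> \<in> U \<Longrightarrow> large_vertices K \<beta> \<subseteq> large_vertices K \<alpha>"
proof
  let ?U = "\<Inter>v\<in>vertices K - large_vertices K \<alpha>. {\<beta>. \<beta> v < cutoff K}"
  show "open ?U"
    using assms by (intro open_INT ballI open_Collect_less) auto
  show "\<alpha> \<in> ?U" by (auto simp: large_vertices_def)
  show "large_vertices K \<beta> \<subseteq> large_vertices K \<alpha>" if "\<beta> \<in> ?U" for \<beta>
    using that by (force simp: large_vertices_def)
qed


section \<open>Open sets with path sections\<close>

definition farber_region :: "'a set set \<Rightarrow> ('a \<times> 'a) set set \<Rightarrow> (('a \<Rightarrow> real) \<times> ('a \<Rightarrow> real)) set"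
  where
  "farber_region K \<Omega> = {(\<alpha>, \<beta>) \<in> realization_points K \<times> realization_points K.
     large_vertices K \<alpha> \<times> large_vertices K \<beta> \<in> \<Omega>}"

definition tensor :: "('a \<Rightarrow> real) \<times> ('b \<Rightarrow> real) \<Rightarrow> 'a \<times> 'b \<Rightarrow> real" where
  "tensor z p = fst z (fst p) * snd z (snd p)"

text \<open>
  Reading barycentric coordinates as probability weights, the tensor product is the product
  distribution, and the realizations of the projections take its marginals.
\<close>

lemma realize_map_tensor:
  assumes "finite (vertices \<Omega>)"
    and \<alpha>: "sum \<alpha> A = 1" "{v. \<alpha> v \<noteq> 0} \<subseteq> A"
    and \<beta>: "sum \<beta> B = 1" "{v. \<beta> v \<noteq> 0} \<subseteq> B"
    and AB: "A \<times> B \<in> \<Omega>"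
  shows "realize_map \<Omega> fst (tensor (\<alpha>, \<beta>)) = \<alpha>" "realize_map \<Omega> snd (tensor (\<alpha>, \<beta>)) = \<beta>"
proof -
  have sub: "A \<times> B \<subseteq> vertices \<Omega>" using AB by (auto simp: vertices_def)
  have AB_nonempty: "A \<noteq> {}" "B \<noteq> {}" using \<alpha>(1) \<beta>(1) by auto
  have "finite (A \<times> B)" using sub assms(1) by (rule finite_subset)
  then have finAB: "finite A" "finite B"
    using AB_nonempty by (auto simp: finite_cartesian_product_iff)
  have restr: "realize_map \<Omega> \<phi> (tensor (\<alpha>, \<beta>)) w
      = (\<Sum>v\<in>A. \<Sum>v'\<in>B. if \<phi> (v, v') = w then \<alpha> v * \<beta> v' else 0)" for \<phi> :: "_ \<Rightarrow> 'c" and w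
  proof -
    have "realize_map \<Omega> \<phi> (tensor (\<alpha>, \<beta>)) w
        = (\<Sum>p\<in>A \<times> B. if \<phi> p = w then tensor (\<alpha>, \<beta>) p else 0)"
      unfolding realize_map_def using sub assms(1) \<alpha>(2) \<beta>(2)
      by (intro sum.mono_neutral_right) (auto simp: tensor_def)
    then show ?thesis
      unfolding sum.cartesian_product case_prod_unfold tensor_def fst_conv snd_conv prod.collapse .
  qed
  show "realize_map \<Omega> fst (tensor (\<alpha>, \<beta>)) = \<alpha>"
  proof
    fix w
    have "realize_map \<Omega> fst (tensor (\<alpha>, \<beta>)) w
        = (\<Sum>v\<in>A. if v = w then \<alpha> v * sum \<beta> B else 0)"
      unfolding restr by (intro sum.cong) (auto simp: sum_distrib_left)
    then show "realize_map \<Omega> fst (tensor (\<alpha>, \<beta>)) w = \<alpha> w"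
      using finAB \<alpha>(2) \<beta>(1) by (auto simp: sum.delta)
  qed
  show "realize_map \<Omega> snd (tensor (\<alpha>, \<beta>)) = \<beta>"
  proof
    fix w
    have "realize_map \<Omega> snd (tensor (\<alpha>, \<beta>)) w
        = (\<Sum>v'\<in>B. if v' = w then sum \<alpha> A * \<beta> v' else 0)"
      unfolding restr
      by (subst sum.swap, intro sum.cong) (auto simp: sum_distrib_right)
    then show "realize_map \<Omega> snd (tensor (\<alpha>, \<beta>)) w = \<beta> w"
      using finAB \<beta>(2) \<alpha>(1) by (auto simp: sum.delta)
  qed
qed

text \<open>
  Near a given point the two sets of large vertices only shrink, so their product passes to a
  face, which still belongs to \<open>\<Omega>\<close>.
\<close>

lemma openin_farber_region:
  assumes K: "abstract_complex K" and fin: "finite (vertices K)" and \<Omega>: "abstract_complex \<Omega>"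
  shows "openin (top_of_set (realization_points K \<times> realization_points K)) (farber_region K \<Omega>)"
proof (subst openin_subopen, intro ballI)
  let ?R = "realization_points K \<times> realization_points K"
  fix z assume z: "z \<in> farber_region K \<Omega>"
  obtain \<alpha> \<beta> where z_eq: "z = (\<alpha>, \<beta>)" by fastforce
  obtain U where U: "open U" "\<alpha> \<in> U"
    "\<And>\<alpha>'. \<alpha>' \<in> U \<Longrightarrow> large_vertices K \<alpha>' \<subseteq> large_vertices K \<alpha>"
    using large_vertices_upper_semicontinuous[OF fin, of \<alpha>] by blast
  obtain W where W: "open W" "\<beta> \<in> W"
    "\<And>\<beta>'. \<beta>' \<in> W \<Longrightarrow> large_vertices K \<beta>' \<subseteq> large_vertices K \<beta>"
    using large_vertices_upper_semicontinuous[OF fin, of \<beta>] by blast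
  have "(\<alpha>', \<beta>') \<in> farber_region K \<Omega>" if "(\<alpha>', \<beta>') \<in> ?R" "\<alpha>' \<in> U" "\<beta>' \<in> W" for \<alpha>' \<beta>'
  proof -
    have "large_vertices K \<alpha>' \<times> large_vertices K \<beta>' \<subseteq> large_vertices K \<alpha> \<times> large_vertices K \<beta>"
      using U(3) W(3) that(2,3) by blast
    moreover have "large_vertices K \<alpha>' \<times> large_vertices K \<beta>' \<noteq> {}"
      using that(1) large_vertices_nonempty[OF K fin] by auto
    moreover have "large_vertices K \<alpha> \<times> large_vertices K \<beta> \<in> \<Omega>"
      using z by (simp add: z_eq farber_region_def)
    ultimately have "large_vertices K \<alpha>' \<times> large_vertices K \<beta>' \<in> \<Omega>"
      using \<Omega> by (metis abstract_complex_face)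
    then show ?thesis using that(1) by (simp add: farber_region_def)
  qed
  then have "?R \<inter> (U \<times> W) \<subseteq> farber_region K \<Omega>" by blast
  moreover have "openin (top_of_set ?R) (?R \<inter> (U \<times> W))"
    using U(1) W(1) by (simp add: open_Times openin_open_Int)
  moreover have "z \<in> ?R \<inter> (U \<times> W)"
    using z U(2) W(2) by (auto simp: z_eq farber_region_def)
  ultimately show "\<exists>T. openin (top_of_set ?R) T \<and> z \<in> T \<and> T \<subseteq> farber_region K \<Omega>"
    by blast
qed

lemma farber_region_projections_homotopic:
  assumes K: "abstract_complex K" and fin: "finite (vertices K)"
    and farber: "farber_subcomplex K \<Omega>"
  shows "homotopic_with_canon (\<lambda>_. True) (farber_region K \<Omega>) (realization_points K) fst snd"
proof -
  let ?V = "farber_region K \<Omega>"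
  let ?hom = "homotopic_with_canon (\<lambda>_. True) ?V (realization_points K)"
  define r where "r = (\<lambda>z. tensor (truncate K (fst z), truncate K (snd z)))"
  have \<Omega>: "abstract_complex \<Omega>" "\<Omega> \<subseteq> categorical_product K K"
    using farber unfolding farber_subcomplex_def subcomplex_def by blast+
  have "vertices \<Omega> \<subseteq> vertices K \<times> vertices K"
    using \<Omega>(2) unfolding vertices_def categorical_product_def by blast
  then have fin\<Omega>: "finite (vertices \<Omega>)"
    using fin by (meson finite_SigmaI finite_subset)
  have V: "fst z \<in> realization_points K" "snd z \<in> realization_points K"
    "large_vertices K (fst z) \<times> large_vertices K (snd z) \<in> \<Omega>" if "z \<in> ?V" for z
    using that by (auto simp: farber_region_def)

  have "r z \<in> realization_points \<Omega>" if z: "z \<in> ?V" for z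
  proof (rule realization_pointsI[OF \<Omega>(1) V(3)[OF z]])
    let ?A = "large_vertices K (fst z)" and ?B = "large_vertices K (snd z)"
    show "0 \<le> r z p" for p
      by (simp add: r_def tensor_def truncate_nonneg[OF K fin])
    show "{p. r z p \<noteq> 0} \<subseteq> ?A \<times> ?B"
      using truncate_support[OF K fin V(1)[OF z]] truncate_support[OF K fin V(2)[OF z]]
      by (auto simp: r_def tensor_def)
    have "sum (r z) (?A \<times> ?B) = sum (truncate K (fst z)) ?A * sum (truncate K (snd z)) ?B"
      by (simp add: r_def tensor_def sum_product sum.cartesian_product case_prod_unfold)
    then show "sum (r z) (?A \<times> ?B) = 1"
      using sum_truncate[OF K fin V(1)[OF z]] sum_truncate[OF K fin V(2)[OF z]] by simp
  qed
  then have r_into: "r \<in> ?V \<rightarrow> realization_points \<Omega>" by blast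

  have r_cont: "continuous_on ?V r"
  proof (rule continuous_on_coordinatewise_then_product)
    fix p
    have "continuous_on ?V (\<lambda>z. truncate K (fst z))" "continuous_on ?V (\<lambda>z. truncate K (snd z))"
      using V(1,2)
      by (auto intro!: continuous_on_compose2[OF continuous_on_truncate[OF K fin]]
          continuous_on_fst continuous_on_snd continuous_on_id)
    then show "continuous_on ?V (\<lambda>z. r z p)"
      unfolding r_def tensor_def fst_conv snd_conv
      by (intro continuous_on_mult continuous_on_coordinate)
  qed

  have "?hom (realize_map \<Omega> fst \<circ> r) (realize_map \<Omega> snd \<circ> r)"
    using farber_subcomplex_projections_homotopic[OF K fin\<Omega> farber]
    by (intro homotopic_with_compose_continuous_right[OF _ r_cont r_into])
  then have mid: "?hom (truncate K \<circ> fst) (truncate K \<circ> snd)"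
  proof (rule homotopic_with_eq)
    fix z assume "z \<in> topspace (top_of_set ?V)"
    then have z: "z \<in> ?V" by simp
    note tensor = realize_map_tensor[OF fin\<Omega> sum_truncate[OF K fin V(1)[OF z]]
        truncate_support[OF K fin V(1)[OF z]] sum_truncate[OF K fin V(2)[OF z]]
        truncate_support[OF K fin V(2)[OF z]] V(3)[OF z]]
    show "(truncate K \<circ> fst) z = (realize_map \<Omega> fst \<circ> r) z"
      "(truncate K \<circ> snd) z = (realize_map \<Omega> snd \<circ> r) z"
      by (simp_all add: r_def tensor)
  qed simp
  have left: "?hom (id \<circ> fst) (truncate K \<circ> fst)"
    using V(1)
    by (intro homotopic_with_compose_continuous_right[where X = "realization_points K"]
        truncate_homotopic_id[OF K fin])
       (auto intro: continuous_on_fst continuous_on_id)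
  have right: "?hom (id \<circ> snd) (truncate K \<circ> snd)"
    using V(2)
    by (intro homotopic_with_compose_continuous_right[where X = "realization_points K"]
        truncate_homotopic_id[OF K fin])
       (auto intro: continuous_on_snd continuous_on_id)
  show ?thesis
    using homotopic_with_trans[OF homotopic_with_trans[OF left mid] homotopic_with_symD[OF right]]
    unfolding id_comp .
qed

lemma farber_regions_cover:
  assumes K: "abstract_complex K" and fin: "finite (vertices K)"
    and cover: "categorical_product K K = (\<Union>j\<le>n. \<Omega> j)"
  shows "realization_points K \<times> realization_points K = (\<Union>j\<le>(n::nat). farber_region K (\<Omega> j))"
proof -
  have "large_vertices K \<alpha> \<times> large_vertices K \<beta> \<in> categorical_product K K"
    if "\<alpha> \<in> realization_points K" "\<beta> \<in> realization_points K" for \<alpha> \<beta>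
  proof -
    have sub: "large_vertices K \<gamma> \<subseteq> vertices K" for \<gamma> by (auto simp: large_vertices_def)
    have "finite (large_vertices K \<alpha> \<times> large_vertices K \<beta>)"
      using finite_subset[OF sub fin] by blast
    with sub show ?thesis
      using that[THEN large_vertices_simplex[OF K fin]]
        that[THEN large_vertices_nonempty[OF K fin]]
      by (simp add: categorical_product_def Sigma_mono)
  qed
  then show ?thesis
    unfolding cover farber_region_def by blast
qed

theorem theorem5p2:
  fixes K :: "'a set set"
  assumes "abstract_complex K" and "finite K"
  shows "topological_complexity (realization K) \<le> discrete_topological_complexity K"
proof -
  have fin: "finite (vertices K)"
    unfolding vertices_def using assms abstract_complex_finite by (metis finite_Union)
  let ?R = "realization_points K"
  have square: "prod_topology (realization K) (realization K) = top_of_set (?R \<times> ?R)"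
    by (simp add: realization_def prod_topology_subtopology_eu)
  have "\<exists>V. (\<forall>j\<le>n. openin (prod_topology (realization K) (realization K)) (V j)
                 \<and> has_path_section (realization K) (V j)) \<and>
            topspace (prod_topology (realization K) (realization K)) = (\<Union>j\<le>n. V j)"
    if farber: "\<forall>j\<le>n. farber_subcomplex K (\<Omega> j)"
      and cover: "categorical_product K K = (\<Union>j\<le>n. \<Omega> j)" for n :: nat and \<Omega>
  proof (intro exI[of _ "\<lambda>j. farber_region K (\<Omega> j)"] conjI allI impI)
    fix j assume "j \<le> n"
    with farber have \<Omega>: "farber_subcomplex K (\<Omega> j)" by blast
    then have "abstract_complex (\<Omega> j)"
      by (simp add: farber_subcomplex_def subcomplex_def)
    then show "openin (prod_topology (realization K) (realization K)) (farber_region K (\<Omega> j))"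
      unfolding square by (rule openin_farber_region[OF assms(1) fin])
    have "farber_region K (\<Omega> j) \<subseteq> ?R \<times> ?R" by (auto simp: farber_region_def)
    then show "has_path_section (realization K) (farber_region K (\<Omega> j))"
      using farber_region_projections_homotopic[OF assms(1) fin \<Omega>]
      by (intro has_path_section_if_projections_homotopic)
         (simp add: square subtopology_subtopology Int_absorb1 realization_def)
  next
    show "topspace (prod_topology (realization K) (realization K))
        = (\<Union>j\<le>n. farber_region K (\<Omega> j))"
      using farber_regions_cover[OF assms(1) fin cover] by (simp add: square)
  qed
  then show ?thesis
    unfolding topological_complexity_def discrete_topological_complexity_def
    by (intro Inf_superset_mono Collect_mono) metis
qed

end
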